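(* Let $K_{p,q}$ be the complete bipartite graph with parts of sizes $p\le q$, on $n=p+q$ vertices. Then: (1) if $p,q>2$, then $K_{p,q}$ has no canonical ESD labeling; (2) if $p=2$, then $K_{p,q}$ has exactly one canonical ESD labeling up to isomorphism; (3) if $p=1$, then every canonical labeling (every bijection $V(K_{1,q})\to\{1,\dots,n\}$) is an ESD labeling.
   Context: For a graph $G=(V,E)$ and $l\in\mathbb N$, a vertex labeling $\phi:V\to\{1,\dots,l\}$ is an edge-sum distinguishing (ESD) labeling if $\phi$ is injective and the edge-weights $w_\phi(uv)=\phi(u)+\phi(v)$ are pairwise distinct over all edges $uv\in E$. It is a canonical ESD labeling if $l=|V|$. Two vertex labelings $\phi_1,\phi_2$ of $G$ are isomorphic if there is an automorphism $f$ of $G$ with $\phi_1(v)=\phi_2(f(v))$ for all $v\in V(G)$. *)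

theory Defs
  imports "Graph_Theory.Kuratowski" "HOL-Library.FuncSet"
begin

(* As in Graph_Theory, a finite simple undirected graph is a loop-free symmetric digraph without
   parallel arcs (locale graph): the undirected edge uv is the pair of arcs (u, v), (v, u).
   In particular complete_bipartite_digraph p q G, written K\<^bsub>p,q\<^esub> G, says that G is such a graph. *)

definition edge_weight :: "('a \<Rightarrow> nat) \<Rightarrow> 'a \<Rightarrow> 'a \<Rightarrow> nat" where
  "edge_weight \<phi> u v = \<phi> u + \<phi> v"

(* Both arcs of an undirected edge have the same weight, so distinctness of weights is required
   only for arcs with different sets of endpoints, i.e. for different undirected edges. *)
definition esd_labeling :: "('a, 'b) pre_digraph \<Rightarrow> nat \<Rightarrow> ('a \<Rightarrow> nat) \<Rightarrow> bool" where
  "esd_labeling G l \<phi> \<longleftrightarrow>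
     \<phi> \<in> verts G \<rightarrow> {1..l} \<and>
     inj_on \<phi> (verts G) \<and>
     (\<forall>u v x y. u \<rightarrow>\<^bsub>G\<^esub> v \<longrightarrow> x \<rightarrow>\<^bsub>G\<^esub> y \<longrightarrow> {u, v} \<noteq> {x, y} \<longrightarrow>
        edge_weight \<phi> u v \<noteq> edge_weight \<phi> x y)"

definition canonical_esd_labeling :: "('a, 'b) pre_digraph \<Rightarrow> ('a \<Rightarrow> nat) \<Rightarrow> bool" where
  "canonical_esd_labeling G \<phi> \<longleftrightarrow> esd_labeling G (card (verts G)) \<phi>"

definition graph_automorphism :: "('a, 'b) pre_digraph \<Rightarrow> ('a \<Rightarrow> 'a) \<Rightarrow> bool" where
  "graph_automorphism G f \<longleftrightarrow>
     bij_betw f (verts G) (verts G) \<and>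
     (\<forall>u\<in>verts G. \<forall>v\<in>verts G. u \<rightarrow>\<^bsub>G\<^esub> v \<longleftrightarrow> f u \<rightarrow>\<^bsub>G\<^esub> f v)"

definition isomorphic_labelings ::
  "('a, 'b) pre_digraph \<Rightarrow> ('a \<Rightarrow> nat) \<Rightarrow> ('a \<Rightarrow> nat) \<Rightarrow> bool" where
  "isomorphic_labelings G \<phi>\<^sub>1 \<phi>\<^sub>2 \<longleftrightarrow>
     (\<exists>f. graph_automorphism G f \<and> (\<forall>v\<in>verts G. \<phi>\<^sub>1 v = \<phi>\<^sub>2 (f v)))"

end

theory Submission
  imports Defs
begin

text \<open>
  A canonical labeling of $K_{p,q}$ with distinct edge sums is a partition of $\{1,\dots,n\}$ into
  sets $A$, $B$ of sizes $p$, $q$ such that the $pq$ sums $a+b$ are distinct. All sums lie in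
  $\{3,\dots,2n-1\}$, so $(p-2)(q-2) \le 1$; for $p,q>2$ only $p=q=3$ remains, where every number
  from $3$ to $11$ has to be a sum, which is impossible by looking at the sums $3,4,10,11$.
  For $A=\{a,a+d\}$, distinctness says that no two elements of $B$ differ by $d$. As $A$ meets few
  of the pairs $\{x,x+d\}$, this forces $A=\{1,n\}$, or $n=4$ and $B=\{1,n\}$.
\<close>

section \<open>Complementary sets of integers with distinct pairwise sums\<close>

abbreviation distinct_sums :: "nat set \<Rightarrow> nat set \<Rightarrow> bool" where
  "distinct_sums A B \<equiv> inj_on (\<lambda>(a, b). a + b) (A \<times> B)"

lemma distinct_sumsD:
  assumes "distinct_sums A B" "a \<in> A" "a' \<in> A" "b \<in> B" "b' \<in> B" "a + b = a' + b'"
  shows "a = a'"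
  using inj_onD[OF assms(1), of "(a, b)" "(a', b')"] assms(2-) by auto

lemma distinct_sums_commute: "distinct_sums A B \<Longrightarrow> distinct_sums B A"
  by (auto simp: inj_on_def add.commute)

text \<open>Disjointness excludes \<open>a = b\<close>, so the extreme possible sums are 1 + 2 and n
  + (n - 1).\<close>

lemma sums_subset:
  fixes n :: nat
  assumes "A \<union> B = {1..n}" "A \<inter> B = {}"
  shows "(\<lambda>(a, b). a + b) ` (A \<times> B) \<subseteq> {3..2 * n - 1}"
proof clarify
  fix a b assume "a \<in> A" "b \<in> B"
  with assms have "a \<in> {1..n}" "b \<in> {1..n}" "a \<noteq> b" by blast+
  then show "a + b \<in> {3..2 * n - 1}" by auto
qed

text \<open>The assumption \<open>one\<close> only breaks the symmetry between \<open>A\<close> and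
  \<open>B\<close>. It makes the small sums 3 and 4 force 2 and 3 into \<open>B\<close>, while the
  large sums 10 and 11 restrict 4, 5 and 6.\<close>

lemma no_distinct_sums_3_3:
  assumes AB: "A \<union> B = {1..6}" "A \<inter> B = {}" and card: "card A = 3" "card B = 3"
    and sums: "distinct_sums A B" and one: "1 \<in> A"
  shows False
proof -
  \<comment> \<open>Nine distinct sums lie among the nine values 3 to 11, so each value is
    attained.\<close>
  have "card ((\<lambda>(a, b). a + b) ` (A \<times> B)) = card {3..2 * 6 - 1::nat}"
    using card_image[OF sums] card by (simp add: card_cartesian_product)
  then have img: "(\<lambda>(a, b). a + b) ` (A \<times> B) = {3..11}"
    using card_subset_eq[OF _ sums_subset[OF AB]] by simp
  have ex: "\<exists>a b. a \<in> A \<and> b \<in> B \<and> s = a + b" if "s \<in> {3..11}" for s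
    using that unfolding img[symmetric] by auto
  have in16: "1 \<le> x \<and> x \<le> 6" if "x \<in> A \<or> x \<in> B" for x
    using AB(1) that by (metis Un_iff atLeastAtMost_iff)
  have "1 \<notin> B" using one AB(2) by blast
  have B2: "2 \<in> B"
  proof -
    obtain a b where ab: "a \<in> A" "b \<in> B" "3 = a + b" using ex[of 3] by auto
    then have "a = 1 \<and> b = 2 \<or> a = 2 \<and> b = 1" using in16[of a] in16[of b] by linarith
    then show ?thesis using ab \<open>1 \<notin> B\<close> by auto
  qed
  have B3: "3 \<in> B"
  proof -
    obtain a b where ab: "a \<in> A" "b \<in> B" "4 = a + b" using ex[of 4] by auto
    then have "a = 1 \<and> b = 3 \<or> a = 2 \<and> b = 2 \<or> a = 3 \<and> b = 1"
      using in16[of a] in16[of b] by linarith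
    then show ?thesis using ab AB(2) \<open>1 \<notin> B\<close> by auto
  qed
  have h5: "5 \<in> A \<and> 6 \<in> B \<or> 6 \<in> A \<and> 5 \<in> B"
  proof -
    obtain a b where ab: "a \<in> A" "b \<in> B" "11 = a + b" using ex[of 11] by auto
    then have "a = 5 \<and> b = 6 \<or> a = 6 \<and> b = 5" using in16[of a] in16[of b] by linarith
    then show ?thesis using ab by auto
  qed
  have h4: "4 \<in> A \<and> 6 \<in> B \<or> 6 \<in> A \<and> 4 \<in> B"
  proof -
    obtain a b where ab: "a \<in> A" "b \<in> B" "10 = a + b" using ex[of 10] by auto
    then have "a = 4 \<and> b = 6 \<or> a = 5 \<and> b = 5 \<or> a = 6 \<and> b = 4"
      using in16[of a] in16[of b] by linarith
    then show ?thesis using ab AB(2) by auto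
  qed
  \<comment> \<open>By \<open>h4\<close> and \<open>h5\<close>, 4 and 5 lie together on the side
    opposite 6. That side cannot be \<open>A\<close>, since 4 + 3 = 5 + 2 with 2 and 3 in
    \<open>B\<close>; but if it is \<open>B\<close>, then \<open>B\<close> has four
    elements.\<close>
  have "\<not> (4 \<in> A \<and> 5 \<in> A)"
    using distinct_sumsD[OF sums, of 4 5 3 2] B2 B3 by auto
  with h4 h5 AB(2) have "4 \<in> B" "5 \<in> B" by blast+
  then have "{2, 3, 4, 5} \<subseteq> B" using B2 B3 by simp
  moreover have "finite B" using card(2) card.infinite by fastforce
  ultimately have "card {2, 3, 4, 5 :: nat} \<le> card B" by (intro card_mono)
  then show False using card by simp
qed

lemma no_distinct_sums:
  assumes AB: "A \<union> B = {1..card A + card B}" "A \<inter> B = {}" and gt: "card A > 2" "card B > 2"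
    and sums: "distinct_sums A B"
  shows False
proof -
  let ?n = "card A + card B"
  have "card ((\<lambda>(a, b). a + b) ` (A \<times> B)) \<le> card {3..2 * ?n - 1}"
    by (rule card_mono[OF _ sums_subset[OF AB]]) simp
  then have le: "card A * card B \<le> 2 * ?n - 3"
    using card_image[OF sums] by (simp add: card_cartesian_product)
  obtain i j where ij: "card A = 3 + i" "card B = 3 + j"
    using gt by (metis Suc_leI add_2_eq_Suc' le_Suc_ex numeral_3_eq_3 One_nat_def Suc_1)
  \<comment> \<open>The bound reads (3 + i)(3 + j) <= 9 + 2i + 2j, that is, i + j + ij <= 0.\<close>
  have "i = 0" "j = 0" using le unfolding ij by (auto simp: algebra_simps)
  then have cards: "card A = 3" "card B = 3" using ij by auto
  then have AB6: "A \<union> B = {1..6}" using AB(1) by simp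
  then have "1 \<in> A \<or> 1 \<in> B" by (simp flip: Un_iff)
  then show False
  proof
    assume "1 \<in> A"
    then show False by (rule no_distinct_sums_3_3[OF AB6 AB(2) cards sums])
  next
    assume "1 \<in> B"
    moreover have "B \<union> A = {1..6}" "B \<inter> A = {}" using AB6 AB(2) by (auto simp: Un_commute)
    ultimately show False
      using no_distinct_sums_3_3 cards distinct_sums_commute[OF sums] by blast
  qed
qed

text \<open>The alternative for \<open>B\<close> is genuine: for n = 4 the sets {1, 4} and {2, 3}
  can be assigned either way round.\<close>

lemma distinct_sums_pair:
  assumes AB: "A \<union> B = {1..n}" "A \<inter> B = {}" and card: "card A = 2" "n \<ge> 4"
    and sums: "distinct_sums A B"
  shows "A = {1, n} \<or> B = {1, n}"
proof -
  obtain a d where A: "A = {a, a + d}" and d: "d > 0"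
  proof -
    obtain x y where "A = {x, y}" "x \<noteq> y" using card by (auto simp: card_2_iff)
    then show ?thesis using that[of x "y - x"] that[of y "x - y"]
      by (cases x y rule: linorder_cases) (auto simp: insert_commute)
  qed
  have rng: "1 \<le> a" "a + d \<le> n" using A AB(1) by (auto simp: set_eq_iff)
  \<comment> \<open>If \<open>x\<close> and \<open>x + d\<close> were both in \<open>B\<close>, then
    a + (x + d) = (a + d) + x would be a repeated sum. Hence \<open>A\<close> meets each such pair;
    the possibility \<open>x + d = a + d\<close> is absorbed by \<open>x = a\<close>.\<close>
  have cover: "x = a \<or> x = a + d \<or> x + d = a" if "1 \<le> x" "x + d \<le> n" for x
  proof (rule ccontr)
    assume "\<not> ?thesis"
    moreover have "x \<in> A \<union> B" "x + d \<in> A \<union> B" using that unfolding AB(1) by auto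
    ultimately have "x \<in> B" "x + d \<in> B" using A by auto
    then show False using distinct_sumsD[OF sums, of a "a + d" "x + d" x] A d by auto
  qed
  show ?thesis
  proof (cases "d = n - 1")
    case True
    then show ?thesis using A rng card by (auto intro: le_antisym)
  next
    case False
    then have d2: "d + 2 \<le> n" using rng by linarith
    \<comment> \<open>Since d + 2 <= n, both {1, 1 + d} and {2, 2 + d} must meet \<open>A\<close>.
      Next, {3, 4} rules out \<open>A = {1, 2}\<close>, and {4, 5} rules out
      \<open>A = {2, 3}\<close> unless n = 4.\<close>
    have "d = 1 \<and> (a = 1 \<or> a = 2)"
      using cover[of 1] cover[of 2] d2 d rng by linarith
    moreover have "a \<noteq> 1" if "d = 1" using cover[of 3] that card by auto
    moreover have "n = 4" if "d = 1" "a = 2"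
      using cover[of 4] that card by (cases "n = 4") auto
    ultimately have "n = 4" "A = {2, 3}" using A by auto
    moreover have "B = {1..n} - A" using AB by blast
    ultimately have "B = {1, n}" by auto
    then show ?thesis by simp
  qed
qed

text \<open>Sums with 1 are at most n and sums with n exceed n, so the two families cannot
  collide.\<close>

lemma distinct_sums_ends:
  assumes "n \<ge> 2"
  shows "distinct_sums {1, n} {2..n - 1}"
  using assms by (auto simp: inj_on_def)

lemma bij_betw_ends_middle:
  assumes "finite U" "finite V" "U \<inter> V = {}" "card U = 2" "n = 2 + card V"
  obtains \<phi> where "bij_betw \<phi> (U \<union> V) {1..n}" "\<phi> ` U = {1, n}" "\<phi> ` V = {2..n - 1}"
proof -
  obtain g where g: "bij_betw g U {1, n}"
    using finite_same_card_bij[of U "{1, n}"] assms by auto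
  have "card V = card {2..n - 1}" using assms by simp
  then obtain h where h: "bij_betw h V {2..n - 1}"
    using finite_same_card_bij assms(2) by blast
  define \<phi> where "\<phi> x = (if x \<in> U then g x else h x)" for x
  have U: "bij_betw \<phi> U {1, n}"
    using g by (subst bij_betw_cong[of _ _ g]) (auto simp: \<phi>_def)
  have V: "bij_betw \<phi> V {2..n - 1}"
    using h assms(3) by (subst bij_betw_cong[of _ _ h]) (auto simp: \<phi>_def)
  have "{1, n} \<union> {2..n - 1} = {1..n}" using assms by auto
  then have "bij_betw \<phi> (U \<union> V) {1..n}"
    using bij_betw_combine[OF U V] assms by auto
  then show ?thesis using that U V by (simp add: bij_betw_def)
qed

section \<open>Labelings of a complete bipartite graph with named parts\<close>

locale complete_bipartite =
  fixes G :: "('a, 'b) pre_digraph" and U V :: "'a set"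
  assumes finite_U: "finite U" and finite_V: "finite V"
    and verts: "verts G = U \<union> V" and disjoint: "U \<inter> V = {}"
    and arcs: "arcs_ends G = U \<times> V \<union> V \<times> U"
begin

lemma card_verts: "card (verts G) = card U + card V"
  using finite_U finite_V verts disjoint by (simp add: card_Un_disjoint)

text \<open>Membership in \<open>U\<close> alone decides adjacency, so a permutation of the vertices
  that preserves it everywhere, or reverses it everywhere, is an automorphism.\<close>

lemma adjacent_iff:
  assumes "u \<in> verts G" "v \<in> verts G"
  shows "(u, v) \<in> arcs_ends G \<longleftrightarrow> (u \<in> U \<longleftrightarrow> v \<notin> U)"
  using assms verts disjoint unfolding arcs by blast

lemma canonical_bij_betw:
  assumes "canonical_esd_labeling G \<phi>"
  shows "bij_betw \<phi> (verts G) {1..card (verts G)}"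
proof -
  have \<phi>: "\<phi> ` verts G \<subseteq> {1..card (verts G)}" "inj_on \<phi> (verts G)"
    using assms by (auto simp: canonical_esd_labeling_def esd_labeling_def)
  then have "\<phi> ` verts G = {1..card (verts G)}"
    by (intro card_subset_eq) (auto simp: card_image)
  then show ?thesis using \<phi> by (simp add: bij_betw_def)
qed

text \<open>This passes from graphs to sets of integers. Undirected edges correspond to pairs in
  \<open>U \<times> V\<close>, and injectivity of \<open>\<phi>\<close> identifies these with pairs
  of labels.\<close>

lemma canonical_esd_iff:
  "canonical_esd_labeling G \<phi> \<longleftrightarrow>
    bij_betw \<phi> (verts G) {1..card (verts G)} \<and> distinct_sums (\<phi> ` U) (\<phi> ` V)"
proof safe
  assume can: "canonical_esd_labeling G \<phi>"
  then show "bij_betw \<phi> (verts G) {1..card (verts G)}" by (rule canonical_bij_betw)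
  have "u = x \<and> v = y" if "u \<in> U" "v \<in> V" "x \<in> U" "y \<in> V" "\<phi> u + \<phi> v = \<phi> x + \<phi> y" for u v x y
  proof -
    have "(u, v) \<in> arcs_ends G" "(x, y) \<in> arcs_ends G" using that arcs by auto
    then have "{u, v} = {x, y}"
      using can that(5)
      unfolding canonical_esd_labeling_def esd_labeling_def edge_weight_def by blast
    then show ?thesis using that disjoint by (auto simp: doubleton_eq_iff)
  qed
  then show "distinct_sums (\<phi> ` U) (\<phi> ` V)" unfolding inj_on_def by clarsimp blast
next
  assume bij: "bij_betw \<phi> (verts G) {1..card (verts G)}"
    and sums: "distinct_sums (\<phi> ` U) (\<phi> ` V)"
  have inj: "inj_on \<phi> (verts G)" using bij by (simp add: bij_betw_def)
  have *: "{u, v} = {x, y}"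
    if "u \<in> U" "v \<in> V" "x \<in> U" "y \<in> V" "\<phi> u + \<phi> v = \<phi> x + \<phi> y" for u v x y
  proof -
    have "\<phi> u = \<phi> x" using distinct_sumsD[OF sums] that by blast
    then have "\<phi> v = \<phi> y" using that by simp
    with \<open>\<phi> u = \<phi> x\<close> show ?thesis using inj_onD[OF inj] that verts by auto
  qed
  \<comment> \<open>Each of the two arcs may run from \<open>U\<close> to \<open>V\<close> or back,
    which accounts for the four instances of \<open>*\<close>.\<close>
  have "{u, v} = {x, y}"
    if "(u, v) \<in> arcs_ends G" "(x, y) \<in> arcs_ends G" "\<phi> u + \<phi> v = \<phi> x + \<phi> y" for u v x y
    using that *[of u v x y] *[of v u x y] *[of u v y x] *[of v u y x] unfolding arcs
    by (auto simp: add.commute insert_commute)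
  moreover have "\<phi> \<in> verts G \<rightarrow> {1..card (verts G)}" using bij by (auto simp: bij_betw_def)
  ultimately show "canonical_esd_labeling G \<phi>"
    using inj unfolding canonical_esd_labeling_def esd_labeling_def edge_weight_def by blast
qed

lemma canonical_image_partition:
  assumes "canonical_esd_labeling G \<phi>"
  shows "\<phi> ` U \<union> \<phi> ` V = {1..card U + card V}" "\<phi> ` U \<inter> \<phi> ` V = {}"
    "card (\<phi> ` U) = card U" "card (\<phi> ` V) = card V"
proof -
  have inj: "inj_on \<phi> (U \<union> V)" and im: "\<phi> ` (U \<union> V) = {1..card U + card V}"
    using canonical_bij_betw[OF assms] verts card_verts by (auto simp: bij_betw_def)
  show "\<phi> ` U \<union> \<phi> ` V = {1..card U + card V}" using im by (simp add: image_Un)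
  show "\<phi> ` U \<inter> \<phi> ` V = {}" using inj disjoint
    by (metis inj_on_image_Int image_empty sup_ge1 sup_ge2)
  show "card (\<phi> ` U) = card U" "card (\<phi> ` V) = card V"
    using inj by (auto intro!: card_image simp: inj_on_Un)
qed

text \<open>The only possible map is \<open>\<psi>\<close> inverted after \<open>\<phi>\<close>.
  Depending on the alternative in \<open>UV\<close>, it fixes both parts or exchanges them, and
  either way it respects adjacency.\<close>

lemma isomorphic_labelingsI:
  assumes \<phi>: "bij_betw \<phi> (verts G) N" and \<psi>: "bij_betw \<psi> (verts G) N"
    and UV: "\<phi> ` U = \<psi> ` U \<or> \<phi> ` U = \<psi> ` V"
  shows "isomorphic_labelings G \<phi> \<psi>"
proof -
  define f where "f = inv_into (verts G) \<psi> \<circ> \<phi>"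
  have f: "bij_betw f (verts G) (verts G)"
    unfolding f_def using \<phi> bij_betw_inv_into[OF \<psi>] by (rule bij_betw_trans)
  have \<psi>f: "\<psi> (f v) = \<phi> v" if "v \<in> verts G" for v
  proof -
    have "\<phi> v \<in> \<psi> ` verts G" using that \<phi> \<psi> by (auto simp: bij_betw_def)
    then show ?thesis by (simp add: f_def f_inv_into_f)
  qed
  have fV: "f v \<in> verts G" if "v \<in> verts G" for v using f that by (auto simp: bij_betw_def)
  have U_iff: "\<phi> v \<in> \<phi> ` U \<longleftrightarrow> v \<in> U" if "v \<in> verts G" for v
    using \<phi> that verts by (auto simp: bij_betw_def dest: inj_onD)
  have part_iff: "\<psi> (f v) \<in> \<psi> ` W \<longleftrightarrow> f v \<in> W" if "v \<in> verts G" "W \<subseteq> verts G" for v W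
    using \<psi> fV[OF that(1)] that(2) by (auto simp: bij_betw_def dest: inj_onD)
  have "(\<forall>v\<in>verts G. f v \<in> U \<longleftrightarrow> v \<in> U) \<or> (\<forall>v\<in>verts G. f v \<in> U \<longleftrightarrow> v \<notin> U)"
    using UV
  proof
    assume "\<phi> ` U = \<psi> ` U"
    then have "f v \<in> U \<longleftrightarrow> v \<in> U" if "v \<in> verts G" for v
      using U_iff[OF that] part_iff[OF that, of U] \<psi>f[OF that] verts by simp
    then show ?thesis by blast
  next
    assume "\<phi> ` U = \<psi> ` V"
    then have "f v \<in> V \<longleftrightarrow> v \<in> U" if "v \<in> verts G" for v
      using U_iff[OF that] part_iff[OF that, of V] \<psi>f[OF that] verts by simp
    then have "f v \<in> U \<longleftrightarrow> v \<notin> U" if "v \<in> verts G" for v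
      using that fV[OF that] verts disjoint by blast
    then show ?thesis by blast
  qed
  then have "(u, v) \<in> arcs_ends G \<longleftrightarrow> (f u, f v) \<in> arcs_ends G"
    if "u \<in> verts G" "v \<in> verts G" for u v
    using that adjacent_iff fV by metis
  then have "graph_automorphism G f"
    using f unfolding graph_automorphism_def by blast
  then show ?thesis using \<psi>f unfolding isomorphic_labelings_def by metis
qed

lemma no_canonical_esd:
  assumes "card U > 2" "card V > 2"
  shows "\<not> canonical_esd_labeling G \<phi>"
proof
  assume can: "canonical_esd_labeling G \<phi>"
  note part = canonical_image_partition[OF can]
  show False
  proof (rule no_distinct_sums)
    show "\<phi> ` U \<union> \<phi> ` V = {1..card (\<phi> ` U) + card (\<phi> ` V)}" unfolding part(3,4) by (rule part(1))
    show "distinct_sums (\<phi> ` U) (\<phi> ` V)" using can canonical_esd_iff by blast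
  qed (use part(2) assms in \<open>simp_all only: part(3,4)\<close>)
qed

lemma unique_canonical_esd:
  assumes U: "card U = 2" and V: "card V \<ge> 2"
  shows "\<exists>\<phi>. canonical_esd_labeling G \<phi> \<and>
    (\<forall>\<psi>. canonical_esd_labeling G \<psi> \<longrightarrow> isomorphic_labelings G \<phi> \<psi>)"
proof -
  let ?n = "2 + card V"
  have n: "card (verts G) = ?n" using card_verts U by simp
  obtain \<phi> where \<phi>: "bij_betw \<phi> (U \<union> V) {1..?n}" "\<phi> ` U = {1, ?n}" "\<phi> ` V = {2..?n - 1}"
    using bij_betw_ends_middle[OF finite_U finite_V disjoint U] by metis
  have "canonical_esd_labeling G \<phi>"
    unfolding canonical_esd_iff n \<phi>(2,3) using \<phi>(1) verts distinct_sums_ends[of ?n] by simp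
  moreover have "isomorphic_labelings G \<phi> \<psi>" if \<psi>: "canonical_esd_labeling G \<psi>" for \<psi>
  proof (rule isomorphic_labelingsI)
    show "bij_betw \<phi> (verts G) {1..?n}" using \<phi>(1) verts by simp
    show "bij_betw \<psi> (verts G) {1..?n}" using canonical_bij_betw[OF \<psi>] n by simp
    note part = canonical_image_partition[OF \<psi>]
    have "\<psi> ` U = {1, ?n} \<or> \<psi> ` V = {1, ?n}"
    proof (rule distinct_sums_pair)
      show "\<psi> ` U \<union> \<psi> ` V = {1..?n}" using part(1) unfolding U .
      show "distinct_sums (\<psi> ` U) (\<psi> ` V)" using \<psi> canonical_esd_iff by blast
    qed (use part(2) U V in \<open>simp_all add: part(3)\<close>)
    \<comment> \<open>The second alternative needs card V = 2; there the automorphism exchanges the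
      parts.\<close>
    then show "\<phi> ` U = \<psi> ` U \<or> \<phi> ` U = \<psi> ` V" unfolding \<phi>(2) by metis
  qed
  ultimately show ?thesis by blast
qed

text \<open>Every sum contains the label of the centre, and cancelling it recovers the label of the
  leaf.\<close>

lemma star_canonical_esd:
  assumes "card U = 1" "bij_betw \<phi> (verts G) {1..card (verts G)}"
  shows "canonical_esd_labeling G \<phi>"
proof -
  obtain c where "U = {c}" using assms(1) card_1_singletonE by blast
  then show ?thesis unfolding canonical_esd_iff using assms(2) by (auto simp: inj_on_def)
qed

end

theorem theorem4:
  fixes G :: "('a, 'b) pre_digraph" and p q n :: nat
  assumes "K\<^bsub>p,q\<^esub> G" and "p \<le> q" and "n = p + q"
  shows "(p > 2 \<and> q > 2 \<longrightarrow> \<not> (\<exists>\<phi>. canonical_esd_labeling G \<phi>)) \<and>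
    (p = 2 \<longrightarrow>
      (\<exists>\<phi>. canonical_esd_labeling G \<phi> \<and>
        (\<forall>\<psi>. canonical_esd_labeling G \<psi> \<longrightarrow> isomorphic_labelings G \<phi> \<psi>))) \<and>
    (p = 1 \<longrightarrow>
      (\<forall>\<phi>. bij_betw \<phi> (verts G) {1..n} \<longrightarrow> canonical_esd_labeling G \<phi>))"
proof -
  obtain U V where UV: "verts G = U \<union> V" "U \<inter> V = {}" "card U = p" "card V = q"
    "arcs_ends G = U \<times> V \<union> V \<times> U" and "graph G"
    using assms(1) unfolding complete_bipartite_digraph_def by blast
  then interpret graph G by simp
  interpret complete_bipartite G U V
    using UV finite_verts by unfold_locales auto
  have "card (verts G) = n" using card_verts UV assms(3) by simp
  \<comment> \<open>In the case p = 2, \<open>p \<le> q\<close> supplies the bound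
    \<open>card V \<ge> 2\<close> that uniqueness requires.\<close>
  then show ?thesis
    using no_canonical_esd unique_canonical_esd star_canonical_esd UV(3,4) assms(2) by metis
qed

end
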